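(* Let $(Y,\tau)$ be a topological space and $(Z,\mathcal{U})$ a uniform space. Then the open-entourage topology on $EC(Y,Z)$ is admissible.
   Context: Uniform spaces $(Z,\mathcal{U})$ are given in the usual sense by a family $\mathcal{U}$ of entourages on a non-empty set $Z$. For $U\in\mathcal{U}$ and $z\in Z$, $U[z]=\{w\in Z : (z,w)\in U\}$. Equi-continuity: a function $f:(X,\tau)\to(Z,\mathcal{U})$ from a topological space to a uniform space is equi-continuous at $x\in X$ if for each $U\in\mathcal{U}$ there is an open neighbourhood $V$ of $x$ with $f(V)\subseteq U[f(x)]$; it is equi-continuous if this holds at all $x\in X$. $EC(Y,Z)$ is the set of all equi-continuous functions from $Y$ to $Z$. Open-entourage topology: the topology on $EC(Y,Z)$ generated by the subbasis consisting of the sets $(V,U)_z=\{f\in EC(Y,Z) : f(V)\subseteq U[z]\}$, for $z\in Z$, $V\in\tau$, $U\in\mathcal{U}$. Admissible: a topology $\mathfrak{T}$ on $EC(Y,Z)$ is admissible if the evaluation map $e:EC(Y,Z)\times Y\to Z$, $e(f,y)=f(y)$, is equi-continuous (where $EC(Y,Z)\times Y$ has the product topology of $\mathfrak{T}$ and $\tau$). *)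

theory Defs
  imports "HOL-Analysis.Analysis"
begin

definition entourage_uniformity :: "'z set \<Rightarrow> ('z \<times> 'z) set set \<Rightarrow> bool" where
  "entourage_uniformity Z \<U> \<longleftrightarrow>
     Z \<noteq> {} \<and> \<U> \<noteq> {} \<and>
     (\<forall>U\<in>\<U>. U \<subseteq> Z \<times> Z \<and> Id_on Z \<subseteq> U) \<and>
     (\<forall>U\<in>\<U>. \<forall>W. U \<subseteq> W \<and> W \<subseteq> Z \<times> Z \<longrightarrow> W \<in> \<U>) \<and>
     (\<forall>U\<in>\<U>. \<forall>W\<in>\<U>. U \<inter> W \<in> \<U>) \<and>
     (\<forall>U\<in>\<U>. U\<inverse> \<in> \<U>) \<and>
     (\<forall>U\<in>\<U>. \<exists>W\<in>\<U>. W O W \<subseteq> U)"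

lemma entourage_uniformity_UNIV:
  "entourage_uniformity (UNIV :: 'a::uniform_space set) {U. eventually (\<lambda>p. p \<in> U) uniformity}"
proof -
  have refl: "Id_on UNIV \<subseteq> U" if "\<forall>\<^sub>F p in uniformity. p \<in> U" for U :: "('a \<times> 'a) set"
    using uniformity_refl[OF that] by auto
  have conv: "\<forall>\<^sub>F p in uniformity. p \<in> U\<inverse>" if "\<forall>\<^sub>F p in uniformity. p \<in> U" for U :: "('a \<times> 'a) set"
    using uniformity_sym[OF that] by (simp add: case_prod_unfold converse_unfold)
  have comp: "\<exists>W. (\<forall>\<^sub>F p in uniformity. p \<in> W) \<and> W O W \<subseteq> U"
    if U: "\<forall>\<^sub>F p in uniformity. p \<in> U" for U :: "('a \<times> 'a) set"
  proof -
    obtain D where D: "eventually D uniformity"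
      "\<And>x y z. D (x, y) \<Longrightarrow> D (y, z) \<Longrightarrow> (x, z) \<in> U"
      using uniformity_transE[OF U] by metis
    then show ?thesis
      by (intro exI[of _ "{p. D p}"]) auto
  qed
  have "{U :: ('a \<times> 'a) set. eventually (\<lambda>p. p \<in> U) uniformity} \<noteq> {}"
    by (auto intro: exI[of _ UNIV])
  then show ?thesis
    unfolding entourage_uniformity_def
    using refl conv comp by (intro conjI; (assumption)?) (auto elim: eventually_mono simp: eventually_conj)
qed

text \<open>\<open>U[z]\<close> is the relational image \<open>U `` {z}\<close>.\<close>

definition equi_continuous_at ::
  "'x topology \<Rightarrow> ('z \<times> 'z) set set \<Rightarrow> ('x \<Rightarrow> 'z) \<Rightarrow> 'x \<Rightarrow> bool" where
  "equi_continuous_at X \<U> f x \<longleftrightarrow>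
     (\<forall>U\<in>\<U>. \<exists>V. openin X V \<and> x \<in> V \<and> f ` V \<subseteq> U `` {f x})"

definition equi_continuous ::
  "'x topology \<Rightarrow> 'z set \<Rightarrow> ('z \<times> 'z) set set \<Rightarrow> ('x \<Rightarrow> 'z) \<Rightarrow> bool" where
  "equi_continuous X Z \<U> f \<longleftrightarrow>
     f \<in> topspace X \<rightarrow> Z \<and> (\<forall>x\<in>topspace X. equi_continuous_at X \<U> f x)"

text \<open>Functions from \<open>Y\<close> to \<open>Z\<close> are represented by the extensional ones (\<open>undefined\<close> outside
  \<open>topspace Y\<close>), so that HOL equality on \<open>EC\<close> is equality of functions on \<open>Y\<close>.\<close>

definition EC ::
  "'y topology \<Rightarrow> 'z set \<Rightarrow> ('z \<times> 'z) set set \<Rightarrow> ('y \<Rightarrow> 'z) set" where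
  "EC Y Z \<U> = {f \<in> topspace Y \<rightarrow>\<^sub>E Z. equi_continuous Y Z \<U> f}"

definition open_entourage_set ::
  "'y topology \<Rightarrow> 'z set \<Rightarrow> ('z \<times> 'z) set set \<Rightarrow> 'y set \<Rightarrow> ('z \<times> 'z) set \<Rightarrow> 'z \<Rightarrow> ('y \<Rightarrow> 'z) set" where
  "open_entourage_set Y Z \<U> V U z = {f \<in> EC Y Z \<U>. f ` V \<subseteq> U `` {z}}"

definition open_entourage_topology ::
  "'y topology \<Rightarrow> 'z set \<Rightarrow> ('z \<times> 'z) set set \<Rightarrow> ('y \<Rightarrow> 'z) topology" where
  "open_entourage_topology Y Z \<U> =
     topology_generated_by
       {open_entourage_set Y Z \<U> V U z | V U z. z \<in> Z \<and> openin Y V \<and> U \<in> \<U>}"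

text \<open>The subbasis covers \<open>EC\<close> because \<open>V = {}\<close> is allowed.\<close>

lemma topspace_open_entourage_topology:
  assumes "entourage_uniformity Z \<U>"
  shows "topspace (open_entourage_topology Y Z \<U>) = EC Y Z \<U>"
proof -
  obtain z U where "z \<in> Z" "U \<in> \<U>"
    using assms by (auto simp: entourage_uniformity_def)
  moreover have "EC Y Z \<U> = open_entourage_set Y Z \<U> {} U z"
    by (simp add: open_entourage_set_def)
  ultimately have "EC Y Z \<U> \<in> {open_entourage_set Y Z \<U> V U z | V U z. z \<in> Z \<and> openin Y V \<and> U \<in> \<U>}"
    using openin_empty by blast
  then show ?thesis
    by (auto simp: open_entourage_topology_def topology_generated_by_topspace open_entourage_set_def)
qed

definition admissible ::
  "'y topology \<Rightarrow> 'z set \<Rightarrow> ('z \<times> 'z) set set \<Rightarrow> ('y \<Rightarrow> 'z) topology \<Rightarrow> bool" where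
  "admissible Y Z \<U> T \<longleftrightarrow>
     topspace T = EC Y Z \<U> \<and>
     equi_continuous (prod_topology T Y) Z \<U> (\<lambda>(f, y). f y)"

end

theory Submission
  imports Defs
begin

text \<open>The subbasis is tailored to evaluation. Given \<open>f\<close>, \<open>y\<close> and an
  entourage \<open>U\<close>, equi-continuity of \<open>f\<close> at \<open>y\<close> yields an open
  \<open>V\<close> around \<open>y\<close> that \<open>f\<close> maps into \<open>U[f(y)]\<close>.
  The same \<open>V\<close> and \<open>U\<close>, with centre \<open>f y\<close>, define a subbasic
  set containing \<open>f\<close>, and all its members obey the same inclusion on \<open>V\<close>.
  Its product with \<open>V\<close> is thus a neighbourhood of \<open>(f, y)\<close> that evaluation
  sends into \<open>U[f(y)]\<close>.\<close>

theorem theorem4p10: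
  fixes Y :: "'y topology" and Z :: "'z set" and \<U> :: "('z \<times> 'z) set set"
  assumes "entourage_uniformity Z \<U>"
  shows "admissible Y Z \<U> (open_entourage_topology Y Z \<U>)"
proof -
  let ?T = "open_entourage_topology Y Z \<U>"
  note top = topspace_open_entourage_topology[OF assms, of Y]
  have ev_into: "(\<lambda>(f, y). f y) \<in> topspace (prod_topology ?T Y) \<rightarrow> Z"
    by (auto simp: top EC_def)
  have ev_at: "equi_continuous_at (prod_topology ?T Y) \<U> (\<lambda>(f, y). f y) (f, y)"
    if f: "f \<in> EC Y Z \<U>" and y: "y \<in> topspace Y" for f y
    unfolding equi_continuous_at_def
  proof
    fix U assume U: "U \<in> \<U>"
    then obtain V where V: "openin Y V" "y \<in> V" "f ` V \<subseteq> U `` {f y}"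
      using f y unfolding EC_def equi_continuous_def equi_continuous_at_def by blast
    let ?N = "open_entourage_set Y Z \<U> V U (f y)"
    \<comment> \<open>Generators of the topology are centred at points of \<open>Z\<close>, so this
      makes \<open>?N\<close> one of them.\<close>
    have "f y \<in> Z"
      using f y by (auto simp: EC_def)
    then have "openin ?T ?N"
      unfolding open_entourage_topology_def
      using U V(1) by (intro topology_generated_by_Basis) blast
    then have "openin (prod_topology ?T Y) (?N \<times> V)"
      using V(1) by (simp add: openin_prod_Times_iff)
    moreover have "(f, y) \<in> ?N \<times> V"
      using f V by (simp add: open_entourage_set_def)
    \<comment> \<open>Membership of \<open>g\<close> in \<open>?N\<close> controls
      \<open>g w\<close> for all \<open>w\<close> in \<open>V\<close> at once, with the centre fixed
      at \<open>f y\<close> rather than at \<open>g y\<close>.\<close>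
    moreover have "(\<lambda>(g, w). g w) ` (?N \<times> V) \<subseteq> U `` {(\<lambda>(g, w). g w) (f, y)}"
      unfolding open_entourage_set_def by fast
    ultimately show "\<exists>W. openin (prod_topology ?T Y) W \<and> (f, y) \<in> W \<and>
        (\<lambda>(g, w). g w) ` W \<subseteq> U `` {(\<lambda>(g, w). g w) (f, y)}"
      by blast
  qed
  have "\<forall>p\<in>topspace (prod_topology ?T Y). equi_continuous_at (prod_topology ?T Y) \<U> (\<lambda>(f, y). f y) p"
    unfolding topspace_prod_topology top using ev_at by blast
  with ev_into top show ?thesis
    unfolding admissible_def equi_continuous_def by blast
qed

end
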